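(* Let $\gamma:\mathbb{R}\to\mathbb{R}^2$ be a smooth open proper rotator for the curve diffusion flow with constant $S\in\mathbb{R}$, i.e. $-\kappa_{ss}=2S\langle\gamma_s,\gamma\rangle$ along $\gamma$. Suppose that $$\lim_{\rho\to\infty}\left(\frac1{\rho^2}\int_{\gamma^{-1}(B_\rho(0))}\kappa^2\,d\ell+\frac{|S|}\rho\int_{\gamma^{-1}(B_{2\rho}(0))}|\langle\nu,\gamma\rangle|\,d\ell\right)=0,$$ where $B_\rho(0)$ denotes the closed ball of radius $\rho$ centred at the origin. Then $\gamma(\mathbb{R})$ is a straight line.
   Context: $s$ is arc length, $d\ell=|\gamma_u|\,du$ the arc length element, $\nu$ a smooth unit normal field, and $\kappa=\langle\gamma_{ss},\nu\rangle$. The curve diffusion flow is $\langle \partial_t\gamma,\nu\rangle=-\kappa_{ss}$. An open curve is a regular immersion $\gamma:\mathbb{R}\to\mathbb{R}^2$ for which there is no pair of intervals $I,J\subset\mathbb{R}$ with $I\cap J=\emptyset$, $|I|=\infty$, $|J|<\infty$ and $\gamma(I)=\gamma(J)$. $\gamma$ is proper if $\gamma^{-1}(C)$ is compact for every compact $C\subset\mathbb{R}^2$. A rotator is a curve satisfying $-\kappa_{ss}\equiv2S\langle\gamma_s,\gamma\rangle$, where $S$ is constant along the curve (it may depend only on time along the flow). *)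

theory Defs
  imports "HOL-Analysis.Analysis"
begin

definition smooth :: "(real \<Rightarrow> 'a::real_normed_vector) \<Rightarrow> bool" where
  "smooth f \<longleftrightarrow>
     (\<forall>n u. ((\<lambda>g t. vector_derivative g (at t)) ^^ n) f differentiable (at u))"

definition regular_immersion :: "(real \<Rightarrow> real ^ 2) \<Rightarrow> bool" where
  "regular_immersion \<gamma> \<longleftrightarrow>
     (\<forall>u. \<gamma> differentiable (at u) \<and> vector_derivative \<gamma> (at u) \<noteq> 0)"

definition speed :: "(real \<Rightarrow> real ^ 2) \<Rightarrow> real \<Rightarrow> real" where
  "speed \<gamma> u = norm (vector_derivative \<gamma> (at u))"

text \<open>Every quantity along the curve is a function of the given parameter \<open>u\<close>. The derivative
  in arc length is \<open>d/ds = (1/|\<gamma>\<^sub>u|) d/du\<close>, and an integral in \<open>d\<ell>\<close> is an integral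
  in \<open>u\<close> with weight \<open>|\<gamma>\<^sub>u|\<close>.\<close>

definition deriv_s :: "(real \<Rightarrow> real ^ 2) \<Rightarrow> (real \<Rightarrow> 'a::real_normed_vector) \<Rightarrow> real \<Rightarrow> 'a" where
  "deriv_s \<gamma> f u = vector_derivative f (at u) /\<^sub>R speed \<gamma> u"

definition arc_integral :: "(real \<Rightarrow> real ^ 2) \<Rightarrow> real set \<Rightarrow> (real \<Rightarrow> real) \<Rightarrow> real" where
  "arc_integral \<gamma> A f = set_lebesgue_integral lborel A (\<lambda>u. f u * speed \<gamma> u)"

definition unit_normal_field :: "(real \<Rightarrow> real ^ 2) \<Rightarrow> (real \<Rightarrow> real ^ 2) \<Rightarrow> bool" where
  "unit_normal_field \<gamma> \<nu> \<longleftrightarrow>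
     smooth \<nu> \<and> (\<forall>u. norm (\<nu> u) = 1 \<and> \<nu> u \<bullet> vector_derivative \<gamma> (at u) = 0)"

definition curvature :: "(real \<Rightarrow> real ^ 2) \<Rightarrow> (real \<Rightarrow> real ^ 2) \<Rightarrow> real \<Rightarrow> real" where
  "curvature \<gamma> \<nu> u = deriv_s \<gamma> (deriv_s \<gamma> \<gamma>) u \<bullet> \<nu> u"

definition open_curve :: "(real \<Rightarrow> real ^ 2) \<Rightarrow> bool" where
  "open_curve \<gamma> \<longleftrightarrow> regular_immersion \<gamma> \<and>
     \<not> (\<exists>I J. is_interval I \<and> is_interval J \<and> I \<inter> J = {} \<and>
          emeasure lborel I = \<infinity> \<and> emeasure lborel J < \<infinity> \<and> \<gamma> ` I = \<gamma> ` J)"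

definition proper_curve :: "(real \<Rightarrow> real ^ 2) \<Rightarrow> bool" where
  "proper_curve \<gamma> \<longleftrightarrow> (\<forall>C. compact C \<longrightarrow> compact (\<gamma> -` C))"

definition rotator :: "(real \<Rightarrow> real ^ 2) \<Rightarrow> (real \<Rightarrow> real ^ 2) \<Rightarrow> real \<Rightarrow> bool" where
  "rotator \<gamma> \<nu> S \<longleftrightarrow>
     (\<forall>u. - deriv_s \<gamma> (deriv_s \<gamma> (curvature \<gamma> \<nu>)) u = 2 * S * (deriv_s \<gamma> \<gamma> u \<bullet> \<gamma> u))"

definition straight_line :: "(real ^ 2) set \<Rightarrow> bool" where
  "straight_line L \<longleftrightarrow> (\<exists>p v. v \<noteq> 0 \<and> L = {p + t *\<^sub>R v | t. True})"

end

theory Submission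
  imports Defs
begin

text \<open>Since \<open>\<kappa> \<langle>\<gamma>\<^sub>s, \<gamma>\<rangle> = - \<langle>\<nu>, \<gamma>\<rangle>\<^sub>s\<close>, the rotator equation multiplied by \<open>\<kappa>\<close> reads
  \<open>\<kappa> \<kappa>\<^sub>s\<^sub>s = 2 S \<langle>\<nu>, \<gamma>\<rangle>\<^sub>s\<close>. Integrated by parts against the squared cutoff
  \<open>\<psi>\<^sup>2\<close>, \<open>\<psi> = max 0 (1 - |\<gamma>|\<^sup>2 / R\<^sup>2)\<close>, it bounds \<open>\<integral> \<kappa>\<^sub>s\<^sup>2 \<psi>\<^sup>2\<close> by the two
  integrals of the growth condition, because \<open>(\<psi>\<^sup>2)\<^sub>s\<close> is at most \<open>4 \<psi> / R\<close>. Letting \<open>R\<close> tend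
  to infinity gives \<open>\<kappa>\<^sub>s = 0\<close>. A nonzero constant curvature would make the
  centre \<open>\<gamma> + \<nu> / \<kappa>\<close> constant and \<open>\<gamma>\<close> bounded, contradicting properness; hence \<open>\<kappa> = 0\<close>.\<close>

section \<open>Finitely often differentiable functions\<close>

text \<open>Finite orders let products, inverses and square roots be treated by induction on
  \<open>n\<close>, since their derivatives are expressions in functions of one order lower. The
  existential lets each computed derivative serve directly as the witness.\<close>

primrec times_differentiable :: "nat \<Rightarrow> (real \<Rightarrow> 'a::real_normed_vector) \<Rightarrow> bool" where
  "times_differentiable 0 f \<longleftrightarrow> True"
| "times_differentiable (Suc n) f \<longleftrightarrow>
     (\<exists>f'. (\<forall>u. (f has_vector_derivative f' u) (at u)) \<and> times_differentiable n f')"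

lemma times_differentiable_SucI:
  assumes "\<And>u. (f has_vector_derivative f' u) (at u)" "times_differentiable n f'"
  shows "times_differentiable (Suc n) f"
  using assms by auto

lemma times_differentiable_SucD:
  assumes "times_differentiable (Suc n) f"
  shows "(f has_vector_derivative vector_derivative f (at u)) (at u)"
    and "times_differentiable n (\<lambda>u. vector_derivative f (at u))"
proof -
  obtain f' where f': "\<And>u. (f has_vector_derivative f' u) (at u)" "times_differentiable n f'"
    using assms by auto
  have eq: "vector_derivative f (at u) = f' u" for u
    using f'(1) by (rule vector_derivative_at)
  show "(f has_vector_derivative vector_derivative f (at u)) (at u)"
    using f'(1) eq by simp
  show "times_differentiable n (\<lambda>u. vector_derivative f (at u))"
    using f'(2) eq by simp
qed

lemma times_differentiable_Suc_imp:
  "times_differentiable (Suc n) f \<Longrightarrow> times_differentiable n f"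
proof (induction n arbitrary: f)
  case (Suc n)
  note f = times_differentiable_SucD[OF Suc.prems]
  show ?case
    by (rule times_differentiable_SucI[OF f(1) Suc.IH[OF f(2)]])
qed simp

lemma smooth_imp_times_differentiable:
  "smooth f \<Longrightarrow> times_differentiable n f"
proof (induction n arbitrary: f)
  case (Suc n)
  let ?D = "\<lambda>g t. vector_derivative g (at t)"
  have "((?D ^^ m) f) differentiable (at u)" for m u
    using Suc.prems by (auto simp: smooth_def)
  \<comment> \<open>Order 0 gives differentiability of \<open>f\<close> itself; the shifted orders
    say that its derivative is again smooth, which feeds the induction.\<close>
  from this[of 0] this[of "Suc _"]
  have 1: "f differentiable (at u)" "smooth (?D f)" for u
    by (auto simp: smooth_def funpow_Suc_right simp del: funpow.simps)
  show ?case
    using Suc.IH[OF 1(2)] 1(1) vector_derivative_works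
    by (intro times_differentiable_SucI[where f'="?D f"]) auto
qed simp

lemma times_differentiable_add:
  "times_differentiable n f \<Longrightarrow> times_differentiable n g \<Longrightarrow>
    times_differentiable n (\<lambda>u. f u + g u)"
proof (induction n arbitrary: f g)
  case (Suc n)
  note f = times_differentiable_SucD[OF Suc.prems(1)]
    and g = times_differentiable_SucD[OF Suc.prems(2)]
  show ?case
    by (rule times_differentiable_SucI[OF has_vector_derivative_add[OF f(1) g(1)]])
      (rule Suc.IH[OF f(2) g(2)])
qed simp

text \<open>Each summand of the product rule keeps one factor undifferentiated. That factor is
  needed at order \<open>n\<close> only, so each hypothesis is also weakened by one order.\<close>

lemma (in bounded_bilinear) times_differentiable:
  "times_differentiable n f \<Longrightarrow> times_differentiable n g \<Longrightarrow>
    times_differentiable n (\<lambda>u. prod (f u) (g u))"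
proof (induction n arbitrary: f g)
  case (Suc n)
  note f = times_differentiable_SucD[OF Suc.prems(1)] times_differentiable_Suc_imp[OF Suc.prems(1)]
    and g = times_differentiable_SucD[OF Suc.prems(2)] times_differentiable_Suc_imp[OF Suc.prems(2)]
  show ?case
    by (rule times_differentiable_SucI[OF has_vector_derivative[OF f(1) g(1)]])
      (intro times_differentiable_add Suc.IH f g)
qed simp

lemmas times_differentiable_inner = bounded_bilinear.times_differentiable[OF bounded_bilinear_inner]
lemmas times_differentiable_scaleR = bounded_bilinear.times_differentiable[OF bounded_bilinear_scaleR]
lemmas times_differentiable_mult = bounded_bilinear.times_differentiable[OF bounded_bilinear_mult]

lemma times_differentiable_const: "times_differentiable n (\<lambda>u. c)"
proof (induction n arbitrary: c)
  case (Suc n)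
  show ?case
    by (rule times_differentiable_SucI[OF has_vector_derivative_const Suc.IH])
qed simp

lemma times_differentiable_inverse:
  fixes f :: "real \<Rightarrow> real"
  shows "times_differentiable n f \<Longrightarrow> (\<And>u. f u \<noteq> 0) \<Longrightarrow> times_differentiable n (\<lambda>u. inverse (f u))"
proof (induction n arbitrary: f)
  case (Suc n)
  note f = times_differentiable_SucD[OF Suc.prems(1)] times_differentiable_Suc_imp[OF Suc.prems(1)]
  let ?f' = "\<lambda>u. vector_derivative f (at u)"
  \<comment> \<open>The derivative is arranged as a product containing two copies of
    \<open>inverse (f u)\<close>, so that the induction hypothesis applies to the inverse itself at
    order \<open>n\<close>.\<close>
  have "((\<lambda>u. inverse (f u)) has_vector_derivative (- 1) * (?f' u * (inverse (f u) * inverse (f u)))) (at u)" for u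
    using f(1)[of u] Suc.prems(2)[of u] unfolding has_real_derivative_iff_has_vector_derivative[symmetric]
    by (auto intro!: derivative_eq_intros simp: field_simps)
  then show ?case
    by (rule times_differentiable_SucI)
      (intro times_differentiable_mult times_differentiable_const Suc f)
qed simp

lemma times_differentiable_sqrt:
  fixes f :: "real \<Rightarrow> real"
  shows "times_differentiable n f \<Longrightarrow> (\<And>u. f u > 0) \<Longrightarrow> times_differentiable n (\<lambda>u. sqrt (f u))"
proof (induction n arbitrary: f)
  case (Suc n)
  note f = times_differentiable_SucD[OF Suc.prems(1)] times_differentiable_Suc_imp[OF Suc.prems(1)]
  let ?f' = "\<lambda>u. vector_derivative f (at u)"
  have nz: "sqrt (f u) \<noteq> 0" for u
    using Suc.prems(2)[of u] by simp
  have "((\<lambda>u. sqrt (f u)) has_vector_derivative (1/2) * (?f' u * inverse (sqrt (f u)))) (at u)" for u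
    using f(1)[of u] Suc.prems(2)[of u] unfolding has_real_derivative_iff_has_vector_derivative[symmetric]
    by (auto intro!: derivative_eq_intros simp: field_simps)
  then show ?case
    by (rule times_differentiable_SucI)
      (intro times_differentiable_mult times_differentiable_const times_differentiable_inverse Suc.IH Suc.prems(2) nz f)
qed simp

text \<open>Regularity makes the squared speed positive, so the square root never meets its
  singularity at 0. One order is spent on the derivative of \<gamma>.\<close>

lemma times_differentiable_speed:
  assumes "regular_immersion \<gamma>" "times_differentiable (Suc n) \<gamma>"
  shows "times_differentiable n (speed \<gamma>)"
proof -
  have "times_differentiable n (\<lambda>u. sqrt (vector_derivative \<gamma> (at u) \<bullet> vector_derivative \<gamma> (at u)))"
    using assms(1)
    by (intro times_differentiable_sqrt times_differentiable_inner times_differentiable_SucD(2) assms(2))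
      (auto simp: regular_immersion_def)
  then show ?thesis
    by (simp add: speed_def[abs_def] norm_eq_sqrt_inner)
qed

lemma times_differentiable_deriv_s:
  assumes "regular_immersion \<gamma>" "times_differentiable (Suc n) \<gamma>" "times_differentiable (Suc n) f"
  shows "times_differentiable n (deriv_s \<gamma> f)"
  unfolding deriv_s_def[abs_def]
  using assms(1)
  by (intro times_differentiable_scaleR times_differentiable_inverse times_differentiable_speed
      times_differentiable_SucD(2) assms)
    (auto simp: regular_immersion_def speed_def)

section \<open>Plane curves\<close>

lemma speed_pos: "regular_immersion \<gamma> \<Longrightarrow> speed \<gamma> u > 0"
  by (simp add: regular_immersion_def speed_def)

lemma norm_deriv_s_curve: "regular_immersion \<gamma> \<Longrightarrow> norm (deriv_s \<gamma> \<gamma> u) = 1"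
  using speed_pos[of \<gamma> u] by (simp add: deriv_s_def speed_def)

lemma has_vector_derivative_deriv_s:
  assumes "regular_immersion \<gamma>" "times_differentiable (Suc 0) f"
  shows "(f has_vector_derivative speed \<gamma> u *\<^sub>R deriv_s \<gamma> f u) (at u)"
  using times_differentiable_SucD(1)[OF assms(2), of u] speed_pos[OF assms(1), of u]
  by (simp add: deriv_s_def)

text \<open>Two orthonormal vectors are independent and hence, by dimension, span the plane; pairing
  with each of them identifies the coefficients.\<close>

lemma orthonormal_expansion_2:
  fixes a b x :: "real ^ 2"
  assumes "norm a = 1" "norm b = 1" "a \<bullet> b = 0"
  shows "x = (x \<bullet> a) *\<^sub>R a + (x \<bullet> b) *\<^sub>R b"
proof -
  have ne: "a \<noteq> b"
    using assms by (auto simp: norm_eq_sqrt_inner)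
  have indep: "independent {a, b}"
    using assms ne by (intro pairwise_orthogonal_independent)
      (auto simp: pairwise_def orthogonal_def inner_commute)
  have "(UNIV :: (real ^ 2) set) \<subseteq> span {a, b}"
    using indep ne by (intro card_ge_dim_independent) auto
  then have "x \<in> span {a, b}"
    by blast
  then obtain p q where "x - p *\<^sub>R a = q *\<^sub>R b"
    unfolding span_insert[of a "{b}"] span_singleton by blast
  then have x: "x = p *\<^sub>R a + q *\<^sub>R b"
    by (metis add.commute diff_add_cancel)
  have "a \<bullet> a = 1" "b \<bullet> b = 1" "b \<bullet> a = 0"
    using assms by (auto simp: norm_eq_1 inner_commute)
  then show ?thesis
    using assms(3) by (simp add: x inner_left_distrib)
qed

text \<open>Differentiating the constant products of the unit tangent and \<nu> with themselves and
  with each other determines all components of both derivatives in the moving frame, in terms of the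
  curvature. The factor \<open>speed\<close> is there because derivatives are taken in the
  parameter, not in arc length.\<close>

lemma frenet:
  assumes reg: "regular_immersion \<gamma>" and \<gamma>: "times_differentiable 2 \<gamma>"
    and \<nu>: "unit_normal_field \<gamma> \<nu>"
  shows "(deriv_s \<gamma> \<gamma> has_vector_derivative (speed \<gamma> u * curvature \<gamma> \<nu> u) *\<^sub>R \<nu> u) (at u)"
    and "(\<nu> has_vector_derivative - (speed \<gamma> u * curvature \<gamma> \<nu> u) *\<^sub>R deriv_s \<gamma> \<gamma> u) (at u)"
proof -
  let ?T = "deriv_s \<gamma> \<gamma>" and ?w = "speed \<gamma> u"
  have \<nu>1: "norm (\<nu> v) = 1" "\<nu> v \<bullet> ?T v = 0" for v
    using \<nu> by (auto simp: unit_normal_field_def deriv_s_def)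
  have \<nu>d: "(\<nu> has_vector_derivative ?w *\<^sub>R deriv_s \<gamma> \<nu> u) (at u)"
    using \<nu> by (intro has_vector_derivative_deriv_s reg smooth_imp_times_differentiable)
      (auto simp: unit_normal_field_def)
  have "times_differentiable (Suc 0) ?T"
    using \<gamma> by (intro times_differentiable_deriv_s reg) (auto simp: numeral_2_eq_2)
  then have Td: "(?T has_vector_derivative ?w *\<^sub>R deriv_s \<gamma> ?T u) (at u)"
    by (rule has_vector_derivative_deriv_s[OF reg])
  note inner_deriv = bounded_bilinear.has_vector_derivative[OF bounded_bilinear_inner]
  have const: "d = 0" if "((\<lambda>v. c) has_vector_derivative d) (at u)" for c d :: real
    using that vector_derivative_at[OF that] by simp
  have TT: "?T v \<bullet> ?T v = 1" "\<nu> v \<bullet> \<nu> v = 1" for v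
    using norm_deriv_s_curve[OF reg, of v] \<nu>1[of v] by (simp_all add: norm_eq_1)
  have w: "?w > 0"
    by (rule speed_pos[OF reg])
  \<comment> \<open>Unfolding \<open>TT\<close> turns the differentiated inner product into a
    constant function, and \<open>const\<close> forces its derivative to be 0.\<close>
  have 1: "deriv_s \<gamma> ?T u \<bullet> ?T u = 0"
    using const[of 1, OF inner_deriv[OF Td Td, unfolded TT]] w by (simp add: inner_commute)
  have 2: "deriv_s \<gamma> \<nu> u \<bullet> \<nu> u = 0"
    using const[of 1, OF inner_deriv[OF \<nu>d \<nu>d, unfolded TT]] w by (simp add: inner_commute)
  have "?w * (\<nu> u \<bullet> deriv_s \<gamma> ?T u + deriv_s \<gamma> \<nu> u \<bullet> ?T u) = 0"
    using const[of 0, OF inner_deriv[OF \<nu>d Td, unfolded \<nu>1]] by (simp add: algebra_simps)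
  then have 3: "deriv_s \<gamma> \<nu> u \<bullet> ?T u = - curvature \<gamma> \<nu> u"
    using w by (simp add: curvature_def inner_commute)
  note ex = orthonormal_expansion_2[OF norm_deriv_s_curve[OF reg] \<nu>1(1), unfolded inner_commute[of "?T _" "\<nu> _"], OF \<nu>1(2)]
  have "deriv_s \<gamma> ?T u = curvature \<gamma> \<nu> u *\<^sub>R \<nu> u"
    using ex[of "deriv_s \<gamma> ?T u" u] unfolding 1 curvature_def by simp
  with Td show "(?T has_vector_derivative (?w * curvature \<gamma> \<nu> u) *\<^sub>R \<nu> u) (at u)"
    by simp
  have "deriv_s \<gamma> \<nu> u = - curvature \<gamma> \<nu> u *\<^sub>R ?T u"
    using ex[of "deriv_s \<gamma> \<nu> u" u] unfolding 2 3 by simp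
  with \<nu>d show "(\<nu> has_vector_derivative - (?w * curvature \<gamma> \<nu> u) *\<^sub>R ?T u) (at u)"
    by simp
qed

lemma times_differentiable_curvature:
  assumes "regular_immersion \<gamma>" "times_differentiable (Suc (Suc n)) \<gamma>" "unit_normal_field \<gamma> \<nu>"
  shows "times_differentiable n (curvature \<gamma> \<nu>)"
proof -
  have "times_differentiable n \<nu>"
    using assms(3) by (simp add: unit_normal_field_def smooth_imp_times_differentiable)
  then show ?thesis
    unfolding curvature_def[abs_def]
    by (intro times_differentiable_inner times_differentiable_deriv_s assms(1,2)
        times_differentiable_Suc_imp[OF assms(2)])
qed

section \<open>Proper curves of constant curvature\<close>

lemma proper_curve_escapes:
  assumes "proper_curve \<gamma>"
  obtains A where "A > 0" "\<And>u. \<bar>u\<bar> \<ge> A \<Longrightarrow> norm (\<gamma> u) > R"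
proof -
  have "bounded (\<gamma> -` cball 0 R)"
    using assms by (auto simp: proper_curve_def intro: compact_imp_bounded)
  then obtain B where "B > 0" "\<forall>u \<in> \<gamma> -` cball 0 R. norm u \<le> B"
    unfolding bounded_pos by blast
  \<comment> \<open>The bound \<open>B\<close> may be attained inside the preimage, so the threshold
    is moved to \<open>B + 1\<close>.\<close>
  then have "norm (\<gamma> u) > R" if "\<bar>u\<bar> \<ge> B + 1" for u
    using that by (intro not_le_imp_less notI) force
  with \<open>B > 0\<close> show thesis
    by (intro that[of "B + 1"]) auto
qed

text \<open>The tangent is a constant \<open>T\<close>, so the curve is
  \<open>p + s u *\<^sub>R T\<close> with \<open>s\<close> increasing. Properness makes
  \<open>s\<close> unbounded at both ends, and the intermediate value theorem fills the whole line
  rather than a segment or a ray.\<close>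

lemma zero_curvature_imp_straight_line:
  assumes reg: "regular_immersion \<gamma>" and \<gamma>: "times_differentiable 2 \<gamma>"
    and proper: "proper_curve \<gamma>" and \<nu>: "unit_normal_field \<gamma> \<nu>"
    and \<kappa>: "\<And>u. curvature \<gamma> \<nu> u = 0"
  shows "straight_line (range \<gamma>)"
proof -
  have "(deriv_s \<gamma> \<gamma> has_vector_derivative 0) (at u within UNIV)" for u
    using frenet(1)[OF reg \<gamma> \<nu>, of u] \<kappa> by simp
  then obtain T where T: "deriv_s \<gamma> \<gamma> u = T" for u
    using has_vector_derivative_zero_constant[of UNIV "deriv_s \<gamma> \<gamma>"] by auto
  have T1: "norm T = 1"
    using norm_deriv_s_curve[OF reg] T by metis
  have TT: "T \<bullet> T = 1"
    using T1 by (simp add: norm_eq_1)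
  have d: "(\<gamma> has_vector_derivative speed \<gamma> u *\<^sub>R T) (at u)" for u
    using has_vector_derivative_deriv_s[OF reg, of \<gamma> u] \<gamma>
    by (simp only: T numeral_2_eq_2 times_differentiable_Suc_imp)
  define s where "s u = \<gamma> u \<bullet> T" for u
  have sd: "(s has_vector_derivative speed \<gamma> u) (at u)" for u
    unfolding s_def[abs_def]
    using bounded_linear.has_vector_derivative[OF bounded_linear_inner_left d, of T u] by (simp add: TT)
  have "((\<lambda>u. s u *\<^sub>R T) has_vector_derivative speed \<gamma> u *\<^sub>R T) (at u)" for u
    by (rule bounded_linear.has_vector_derivative[OF bounded_linear_scaleR_left sd])
  from has_vector_derivative_diff[OF d this]
  have "((\<lambda>u. \<gamma> u - s u *\<^sub>R T) has_vector_derivative 0) (at u within UNIV)" for u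
    by simp
  then obtain p where "\<gamma> u - s u *\<^sub>R T = p" for u
    using has_vector_derivative_zero_constant[of UNIV "\<lambda>u. \<gamma> u - s u *\<^sub>R T"] by auto
  then have p: "\<gamma> u = p + s u *\<^sub>R T" for u
    by (metis add.commute diff_add_cancel)
  have s_mono: "s a \<le> s b" if "a \<le> b" for a b
    using that sd speed_pos[OF reg]
    by (intro DERIV_nonneg_imp_nondecreasing[of a b s])
      (auto simp: has_real_derivative_iff_has_vector_derivative intro: less_imp_le)
  have s_cont: "continuous_on A s" for A
    using sd by (meson continuous_at_imp_continuous_on has_vector_derivative_continuous)
  have surj: "\<exists>u. s u = t" for t
  proof -
    \<comment> \<open>The term \<open>norm p\<close> turns the lower bound on the norm of \<gamma>
      into one on the absolute value of \<open>s\<close>. The term \<open>\<bar>s 0\<bar>\<close>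
      fixes the sign: by monotonicity \<open>s A\<close> cannot be below \<open>s 0\<close>, nor
      \<open>s (-A)\<close> above it.\<close>
    obtain A where A: "A > 0" "\<And>u. \<bar>u\<bar> \<ge> A \<Longrightarrow> norm (\<gamma> u) > norm p + \<bar>t\<bar> + \<bar>s 0\<bar>"
      using proper_curve_escapes[OF proper] by blast
    have "norm (\<gamma> u) \<le> norm p + \<bar>s u\<bar>" for u
      using norm_triangle_ineq[of p "s u *\<^sub>R T"] by (simp add: p T1)
    then have "\<bar>s A\<bar> > \<bar>t\<bar> + \<bar>s 0\<bar>" "\<bar>s (-A)\<bar> > \<bar>t\<bar> + \<bar>s 0\<bar>"
      using A(2)[of A] A(2)[of "-A"] A(1) by (smt (verit))+
    then have "s (-A) \<le> t" "t \<le> s A"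
      using s_mono[of 0 A] s_mono[of "-A" 0] A(1) by auto
    then show ?thesis
      using IVT'[of s "-A" t A] s_cont A(1) by auto
  qed
  have "range \<gamma> = {p + t *\<^sub>R T | t. True}"
    using p surj by (auto simp: image_iff) metis
  moreover have "T \<noteq> 0"
    using T1 by auto
  ultimately show ?thesis
    unfolding straight_line_def by blast
qed

lemma constant_curvature_proper_imp_zero:
  assumes reg: "regular_immersion \<gamma>" and \<gamma>: "times_differentiable 2 \<gamma>"
    and proper: "proper_curve \<gamma>" and \<nu>: "unit_normal_field \<gamma> \<nu>"
    and \<kappa>: "\<And>u. curvature \<gamma> \<nu> u = c"
  shows "c = 0"
proof (rule ccontr)
  assume c: "c \<noteq> 0"
  have d: "(\<gamma> has_vector_derivative speed \<gamma> u *\<^sub>R deriv_s \<gamma> \<gamma> u) (at u)" for u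
    using has_vector_derivative_deriv_s[OF reg, of \<gamma> u] \<gamma>
    by (simp only: numeral_2_eq_2 times_differentiable_Suc_imp)
  have "((\<lambda>u. (1 / c) *\<^sub>R \<nu> u) has_vector_derivative - (speed \<gamma> u *\<^sub>R deriv_s \<gamma> \<gamma> u)) (at u)" for u
    using bounded_linear.has_vector_derivative[OF bounded_linear_scaleR_right[of "1 / c"]
        frenet(2)[OF reg \<gamma> \<nu>, of u]] c
    by (simp add: \<kappa>)
  \<comment> \<open>The two tangential terms cancel, so the centre of the osculating circle does not
    move.\<close>
  from has_vector_derivative_add[OF d this]
  have "((\<lambda>u. \<gamma> u + (1 / c) *\<^sub>R \<nu> u) has_vector_derivative 0) (at u within UNIV)" for u
    by simp
  then obtain p where p: "\<gamma> u + (1 / c) *\<^sub>R \<nu> u = p" for u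
    using has_vector_derivative_zero_constant[of UNIV "\<lambda>u. \<gamma> u + (1 / c) *\<^sub>R \<nu> u"] by auto
  have "norm (\<gamma> u) \<le> norm p + \<bar>1 / c\<bar>" for u
  proof -
    have "\<gamma> u = p - (1 / c) *\<^sub>R \<nu> u"
      using p[of u] by (metis add_diff_cancel_right')
    moreover have "norm (\<nu> u) = 1"
      using \<nu> by (simp add: unit_normal_field_def)
    ultimately show ?thesis
      using norm_triangle_ineq4[of p "(1 / c) *\<^sub>R \<nu> u"] by simp
  qed
  moreover obtain A where "A > 0" "\<And>u. \<bar>u\<bar> \<ge> A \<Longrightarrow> norm (\<gamma> u) > norm p + \<bar>1 / c\<bar>"
    using proper_curve_escapes[OF proper] by blast
  ultimately show False
    by (metis abs_ge_self not_less)
qed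

section \<open>The localized energy estimate\<close>

text \<open>Squaring removes the kink of the positive part: at 0 the difference quotient is bounded
  by \<open>\<bar>h\<bar>\<close>. For this reason the cutoff is differentiated only in squared
  form.\<close>

lemma has_real_derivative_pos_part_power2:
  fixes x :: real
  shows "((\<lambda>x. (max 0 x)\<^sup>2) has_real_derivative 2 * max 0 x) (at x)"
proof (cases x "0 :: real" rule: linorder_cases)
  case less
  have "((\<lambda>x. 0) has_real_derivative 2 * max 0 x) (at x)"
    using less by simp
  then show ?thesis
    by (rule has_field_derivative_transform_within_open[where S="{..<0}"]) (use less in auto)
next
  case equal
  have "\<bar>(max 0 h)\<^sup>2 / h\<bar> \<le> \<bar>h\<bar>" for h :: real
    by (cases "h \<le> 0") (simp_all add: power2_eq_square)
  then have "\<forall>\<^sub>F h :: real in at 0. norm ((max 0 h)\<^sup>2 / h) \<le> \<bar>h\<bar>"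
    by (simp only: real_norm_def eventually_True)
  moreover have "(\<lambda>h :: real. \<bar>h\<bar>) \<midarrow>0\<rightarrow> 0"
    by (rule tendsto_rabs_zero[OF tendsto_ident_at])
  ultimately have "(\<lambda>h :: real. (max 0 h)\<^sup>2 / h) \<midarrow>0\<rightarrow> 0"
    by (rule Lim_null_comparison)
  then show ?thesis
    by (simp add: equal DERIV_def)
next
  case greater
  have "((\<lambda>x. x\<^sup>2) has_real_derivative 2 * max 0 x) (at x)"
    using greater by (auto intro!: derivative_eq_intros)
  then show ?thesis
    by (rule has_field_derivative_transform_within_open[where S="{0<..}"]) (use greater in auto)
qed

text \<open>The squared norm is differentiable at the origin as well, so for positive
  \<open>R\<close> the only kink lies on the circle of radius \<open>R\<close>, where squaring the
  cutoff removes it.\<close>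

definition cutoff :: "real \<Rightarrow> real ^ 2 \<Rightarrow> real" where
  "cutoff R x = max 0 (1 - (norm x)\<^sup>2 / R\<^sup>2)"

lemma cutoff_nonneg: "cutoff R x \<ge> 0"
  by (simp add: cutoff_def)

lemma cutoff_le_1: "cutoff R x \<le> 1"
  by (simp add: cutoff_def)

lemma cutoff_eq_0: "R > 0 \<Longrightarrow> norm x \<ge> R \<Longrightarrow> cutoff R x = 0"
  by (simp add: cutoff_def)

text \<open>Lets the cutoff energy control the energy of any piece of curve inside the ball of half
  the radius. The cutoff is in fact at least 3/4 there.\<close>

lemma cutoff_ge_half:
  assumes "R > 0" "2 * norm x \<le> R"
  shows "cutoff R x \<ge> 1 / 2"
proof -
  have "(2 * norm x)\<^sup>2 \<le> R\<^sup>2"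
    using assms by (intro power_mono) auto
  then have "(norm x)\<^sup>2 / R\<^sup>2 \<le> 1 / 2"
    using assms(1) by (auto simp: field_simps) (use zero_le_power2[of "norm x"] in linarith)
  then show ?thesis
    by (auto simp: cutoff_def le_max_iff_disj)
qed

lemma has_real_derivative_cutoff_power2:
  assumes "(\<gamma> has_vector_derivative d) (at u)"
  shows "((\<lambda>u. (cutoff R (\<gamma> u))\<^sup>2) has_real_derivative
     - 4 * cutoff R (\<gamma> u) * (d \<bullet> \<gamma> u) / R\<^sup>2) (at u)"
proof -
  have "((\<lambda>u. \<gamma> u \<bullet> \<gamma> u) has_real_derivative 2 * (d \<bullet> \<gamma> u)) (at u)"
    using bounded_bilinear.has_vector_derivative[OF bounded_bilinear_inner assms assms]
    by (simp add: has_real_derivative_iff_has_vector_derivative inner_commute)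
  then have "((\<lambda>u. 1 - \<gamma> u \<bullet> \<gamma> u / R\<^sup>2) has_real_derivative - (2 * (d \<bullet> \<gamma> u) / R\<^sup>2)) (at u)"
    using DERIV_diff[OF DERIV_const DERIV_cdivide] by fastforce
  from DERIV_chain2[OF has_real_derivative_pos_part_power2 this] show ?thesis
    by (simp add: cutoff_def power2_norm_eq_inner mult.assoc)
qed

text \<open>Moves the Lebesgue integral over a preimage to a gauge integral over an interval, where
  it can be compared with the fundamental theorem of calculus. Compactness and continuity secure
  integrability.\<close>

lemma arc_integral_eq_integral:
  assumes "compact K" "K \<subseteq> {a..b}" and f: "continuous_on UNIV f" "continuous_on UNIV (speed \<gamma>)"
  shows "((\<lambda>u. indicator K u * (f u * speed \<gamma> u)) has_integral arc_integral \<gamma> K f) {a..b}"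
proof -
  have int: "set_integrable lborel K (\<lambda>u. f u * speed \<gamma> u)"
    unfolding set_integrable_def
    using assms(1) by (intro borel_integrable_compact continuous_on_subset[OF continuous_on_mult[OF f]]) auto
  have "((\<lambda>u. f u * speed \<gamma> u) has_integral arc_integral \<gamma> K f) K"
    using set_borel_integral_eq_integral[OF int] unfolding arc_integral_def
    by (simp add: has_integral_iff)
  then have "((\<lambda>u. if u \<in> K then f u * speed \<gamma> u else 0) has_integral arc_integral \<gamma> K f) {a..b}"
    using assms(2) by (simp add: has_integral_restrict)
  then show ?thesis
    by (rule has_integral_eq[rotated]) (auto simp: indicator_def)
qed

text \<open>Pointwise Young inequality. Here \<open>k\<close> and \<open>k1\<close> stand for
  \<kappa> and its arc length derivative, \<open>t\<close> and \<open>n\<close> for the tangential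
  and normal components of \<gamma>, and \<open>\<psi>\<close> for the cutoff; half of the energy
  density absorbs the mixed term.\<close>

lemma cutoff_cross_term_bound:
  fixes k k1 \<psi> t n R S :: real
  assumes "0 \<le> \<psi>" "\<psi> \<le> 1" "\<bar>t\<bar> \<le> R" "R > 0"
  shows "\<psi>\<^sup>2 * k1\<^sup>2 / 2 \<le> k1\<^sup>2 * \<psi>\<^sup>2 + (k * k1 - 2 * S * n) * (- 4 * \<psi> * t / R\<^sup>2)
     + (8 / R\<^sup>2 * k\<^sup>2 + 8 * \<bar>S\<bar> / R * \<bar>n\<bar>)"
proof -
  define r where "r = t / R"
  have r: "\<bar>r\<bar> \<le> 1" and e: "- 4 * \<psi> * t / R\<^sup>2 = - 4 * \<psi> * r / R"
    using assms by (auto simp: r_def power2_eq_square)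
  \<comment> \<open>The coefficient 4 makes half of this square contain exactly the mixed term
    \<open>4 * \<psi> * r * k * k1 / R\<close>.\<close>
  have "0 \<le> (\<psi> * k1 - 4 * r * k / R)\<^sup>2"
    by simp
  then have "4 * \<psi> * r * k * k1 / R \<le> (\<psi> * k1)\<^sup>2 / 2 + 8 * r\<^sup>2 * (k\<^sup>2 / R\<^sup>2)"
    using assms(4) by (simp add: power2_diff power_mult_distrib power_divide) (simp add: field_simps)
  moreover have "r\<^sup>2 * (k\<^sup>2 / R\<^sup>2) \<le> 1 * (k\<^sup>2 / R\<^sup>2)"
    using r by (intro mult_right_mono) (auto simp: abs_square_le_1)
  moreover have "\<bar>\<psi> * r * (S * n / R)\<bar> \<le> \<bar>S * n / R\<bar>"
  proof -
    have "\<bar>\<psi>\<bar> * \<bar>r\<bar> \<le> 1"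
      using r assms by (intro mult_le_one) auto
    then show ?thesis
      by (simp only: abs_mult mult_left_le_one_le abs_ge_zero mult_nonneg_nonneg)
  qed
  then have "- (\<psi> * r * (S * n / R)) \<le> \<bar>S\<bar> / R * \<bar>n\<bar>"
    using assms(4) abs_ge_minus_self[of "\<psi> * r * (S * n / R)"] by (simp add: abs_mult)
  ultimately show ?thesis
    unfolding e by (simp add: power_mult_distrib algebra_simps)
qed

text \<open>\<open>E\<close> carries only half of the cutoff energy, the other half being spent on
  the mixed term. The bound is independent of \<open>a\<close> and \<open>b\<close>, so
  \<open>R\<close> can later grow while the interval stays fixed.\<close>

lemma rotator_energy_estimate:
  assumes reg: "regular_immersion \<gamma>" and \<gamma>: "\<And>n. times_differentiable n \<gamma>"
    and proper: "proper_curve \<gamma>" and \<nu>: "unit_normal_field \<gamma> \<nu>" and rot: "rotator \<gamma> \<nu> S"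
    and R: "R > 0"
  defines "E \<equiv> \<lambda>u. (cutoff R (\<gamma> u))\<^sup>2 * (deriv_s \<gamma> (curvature \<gamma> \<nu>) u)\<^sup>2 / 2 * speed \<gamma> u"
  shows "integral {a..b} E \<le>
     8 / R\<^sup>2 * arc_integral \<gamma> (\<gamma> -` cball 0 R) (\<lambda>u. (curvature \<gamma> \<nu> u)\<^sup>2)
     + 8 * \<bar>S\<bar> / R * arc_integral \<gamma> (\<gamma> -` cball 0 R) (\<lambda>u. \<bar>\<nu> u \<bullet> \<gamma> u\<bar>)"
proof -
  let ?w = "speed \<gamma>" and ?T = "deriv_s \<gamma> \<gamma>" and ?k = "curvature \<gamma> \<nu>"
  let ?k1 = "deriv_s \<gamma> ?k" and ?\<psi> = "\<lambda>u. cutoff R (\<gamma> u)" and ?K = "\<gamma> -` cball 0 R"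
  have w: "?w u > 0" for u
    by (rule speed_pos[OF reg])
  have \<gamma>2: "times_differentiable 2 \<gamma>"
    by (rule \<gamma>)
  have cont: "continuous_on UNIV f" if "times_differentiable (Suc 0) f" for f :: "real \<Rightarrow> 'c::real_normed_vector"
    using times_differentiable_SucD(1)[OF that]
    by (meson continuous_at_imp_continuous_on has_vector_derivative_continuous)
  have tk: "times_differentiable n ?k" for n
    by (intro times_differentiable_curvature reg \<gamma> \<nu>)
  have tk1: "times_differentiable n ?k1" for n
    by (intro times_differentiable_deriv_s tk reg \<gamma>)
  have t\<nu>: "times_differentiable n \<nu>" for n
    using \<nu> by (auto simp: unit_normal_field_def intro: smooth_imp_times_differentiable)
  note conts = cont[OF times_differentiable_speed[OF reg \<gamma>]] cont[OF tk] cont[OF tk1] cont[OF t\<nu>] cont[OF \<gamma>]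
  have cont_\<psi>: "continuous_on UNIV ?\<psi>"
    unfolding cutoff_def using R by (intro continuous_intros conts) auto
  have d\<gamma>: "(\<gamma> has_vector_derivative ?w u *\<^sub>R ?T u) (at u)" for u
    by (rule has_vector_derivative_deriv_s[OF reg \<gamma>])
  have dk: "(?k has_real_derivative ?w u * ?k1 u) (at u)" for u
    using has_vector_derivative_deriv_s[OF reg tk]
    by (simp add: has_real_derivative_iff_has_vector_derivative)
  have k2: "deriv_s \<gamma> ?k1 u = - (2 * S * (?T u \<bullet> \<gamma> u))" for u
    using rot[unfolded rotator_def, rule_format, of u] by simp
  have dk1: "(?k1 has_real_derivative - ?w u * (2 * S * (?T u \<bullet> \<gamma> u))) (at u)" for u
    using has_vector_derivative_deriv_s[OF reg tk1, of u]
    by (simp add: has_real_derivative_iff_has_vector_derivative k2)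
  have \<nu>T: "\<nu> u \<bullet> ?T u = 0" for u
    using \<nu> by (simp add: unit_normal_field_def deriv_s_def)
  have dn: "((\<lambda>u. \<nu> u \<bullet> \<gamma> u) has_real_derivative - ?w u * ?k u * (?T u \<bullet> \<gamma> u)) (at u)" for u
    using bounded_bilinear.has_vector_derivative[OF bounded_bilinear_inner frenet(2)[OF reg \<gamma>2 \<nu>] d\<gamma>, of u]
    by (simp add: has_real_derivative_iff_has_vector_derivative \<nu>T)
  define p where "p u = - 4 * ?\<psi> u * (?T u \<bullet> \<gamma> u) / R\<^sup>2" for u
  have d\<psi>: "((\<lambda>u. (?\<psi> u)\<^sup>2) has_real_derivative ?w u * p u) (at u)" for u
    using has_real_derivative_cutoff_power2[OF d\<gamma>, of R u] by (simp add: p_def algebra_simps)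
  \<comment> \<open>In the derivative of the first factor, the rotator equation contributes
    \<open>- 2 * S * ?k u * (?T u \<bullet> \<gamma> u)\<close> and Frenet the opposite term, up to
    the speed. Only the square of \<open>?k1\<close> survives, and integration by parts becomes the
    fundamental theorem for \<open>G\<close>.\<close>
  define G where "G u = (?k u * ?k1 u - 2 * S * (\<nu> u \<bullet> \<gamma> u)) * (?\<psi> u)\<^sup>2" for u
  define G' where "G' u = ((?k1 u)\<^sup>2 * (?\<psi> u)\<^sup>2 + (?k u * ?k1 u - 2 * S * (\<nu> u \<bullet> \<gamma> u)) * p u) * ?w u" for u
  have dG: "(G has_real_derivative G' u) (at u)" for u
    unfolding G_def[abs_def]
    by (rule derivative_eq_intros dk dk1 dn d\<psi> refl)+
       (simp add: G'_def power2_eq_square algebra_simps)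
  obtain A0 where A0: "A0 > 0" "\<And>u. \<bar>u\<bar> \<ge> A0 \<Longrightarrow> norm (\<gamma> u) > R"
    using proper_curve_escapes[OF proper] by blast
  \<comment> \<open>Large enough for both endpoints to leave the ball, where the cutoff kills the
    boundary terms, and for \<open>{a..b}\<close> to be covered.\<close>
  define A where "A = max A0 (max \<bar>a\<bar> \<bar>b\<bar>)"
  have A: "A \<ge> A0" "{a..b} \<subseteq> {-A..A}" "-A \<le> A"
    using A0(1) by (auto simp: A_def)
  have G0: "G A = 0" "G (-A) = 0"
    using A0(2)[of A] A0(2)[of "-A"] A(1) A0(1) cutoff_eq_0[OF R] by (auto simp: G_def)
  have intG: "(G' has_integral 0) {-A..A}"
    using fundamental_theorem_of_calculus[OF A(3), of G G'] dG G0
    by (simp add: has_real_derivative_iff_has_vector_derivative has_vector_derivative_at_within)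
  have K: "compact ?K" "?K \<subseteq> {-A..A}"
    using proper A0 A(1) by (auto simp: proper_curve_def) (smt (verit))+
  let ?I1 = "\<lambda>u. indicator ?K u * ((?k u)\<^sup>2 * ?w u)"
  let ?I2 = "\<lambda>u. indicator ?K u * (\<bar>\<nu> u \<bullet> \<gamma> u\<bar> * ?w u)"
  let ?i1 = "arc_integral \<gamma> ?K (\<lambda>u. (?k u)\<^sup>2)"
  let ?i2 = "arc_integral \<gamma> ?K (\<lambda>u. \<bar>\<nu> u \<bullet> \<gamma> u\<bar>)"
  have I1: "(?I1 has_integral ?i1) {-A..A}" and I2: "(?I2 has_integral ?i2) {-A..A}"
    by (intro arc_integral_eq_integral K continuous_intros conts)+
  have rhs: "((\<lambda>u. G' u + (8 / R\<^sup>2 * ?I1 u + 8 * \<bar>S\<bar> / R * ?I2 u)) has_integral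
      0 + (8 / R\<^sup>2 * ?i1 + 8 * \<bar>S\<bar> / R * ?i2)) {-A..A}"
    by (intro has_integral_add intG has_integral_mult_right I1 I2)
  have contE: "continuous_on X E" for X
    unfolding E_def by (rule continuous_on_subset[OF _ subset_UNIV]) (intro continuous_intros conts cont_\<psi>, auto)
  have E_nonneg: "E u \<ge> 0" for u
    using w[of u] by (simp add: E_def less_imp_le)
  have pointwise: "E u \<le> G' u + (8 / R\<^sup>2 * ?I1 u + 8 * \<bar>S\<bar> / R * ?I2 u)" for u
  proof (cases "u \<in> ?K")
    case True
    have "\<bar>?T u \<bullet> \<gamma> u\<bar> \<le> R"
      using Cauchy_Schwarz_ineq2[of "?T u" "\<gamma> u"] True norm_deriv_s_curve[OF reg, of u] by simp
    from mult_right_mono[OF cutoff_cross_term_bound[OF cutoff_nonneg cutoff_le_1 this R] less_imp_le[OF w]]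
    have "E u \<le> ((?k1 u)\<^sup>2 * (?\<psi> u)\<^sup>2 + (?k u * ?k1 u - 2 * S * (\<nu> u \<bullet> \<gamma> u)) * p u
       + (8 / R\<^sup>2 * (?k u)\<^sup>2 + 8 * \<bar>S\<bar> / R * \<bar>\<nu> u \<bullet> \<gamma> u\<bar>)) * ?w u"
      unfolding E_def p_def .
    then show ?thesis
      using True by (simp add: G'_def algebra_simps)
  next
    \<comment> \<open>Outside the ball the cutoff vanishes, and with it \<open>E\<close> and both
      terms of \<open>G'\<close>; the indicators vanish too.\<close>
    case False
    then show ?thesis
      using cutoff_eq_0[OF R, of "\<gamma> u"] by (simp add: E_def G'_def p_def)
  qed
  have "integral {a..b} E \<le> integral {-A..A} E"
    using A(2) E_nonneg by (intro integral_subset_le integrable_continuous_interval contE) auto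
  also have "\<dots> \<le> 0 + (8 / R\<^sup>2 * ?i1 + 8 * \<bar>S\<bar> / R * ?i2)"
    using pointwise
    by (intro has_integral_le[OF integrable_integral rhs] integrable_continuous_interval contE) auto
  finally show ?thesis
    by simp
qed

section \<open>Passage to the limit over large balls\<close>

lemma arc_integral_nonneg:
  assumes "\<And>u. f u \<ge> 0"
  shows "arc_integral \<gamma> K f \<ge> 0"
  using assms unfolding arc_integral_def set_lebesgue_integral_def
  by (intro integral_nonneg_AE) (auto simp: speed_def)

theorem proposition16:
  fixes \<gamma> \<nu> :: "real \<Rightarrow> real ^ 2" and S :: real
  assumes "smooth \<gamma>"
    and "open_curve \<gamma>"
    and "proper_curve \<gamma>"
    and "unit_normal_field \<gamma> \<nu>"
    and "rotator \<gamma> \<nu> S"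
    and "((\<lambda>\<rho>. 1 / \<rho>\<^sup>2 * arc_integral \<gamma> (\<gamma> -` cball 0 \<rho>) (\<lambda>u. (curvature \<gamma> \<nu> u)\<^sup>2)
            + \<bar>S\<bar> / \<rho> * arc_integral \<gamma> (\<gamma> -` cball 0 (2 * \<rho>)) (\<lambda>u. \<bar>\<nu> u \<bullet> \<gamma> u\<bar>))
          \<longlongrightarrow> 0) at_top"
  shows "straight_line (range \<gamma>)"
proof -
  have reg: "regular_immersion \<gamma>"
    using assms(2) by (simp add: open_curve_def)
  have \<gamma>: "times_differentiable n \<gamma>" for n
    by (rule smooth_imp_times_differentiable[OF assms(1)])
  let ?k = "curvature \<gamma> \<nu>" and ?w = "speed \<gamma>"
  let ?k1 = "deriv_s \<gamma> ?k"
  let ?e = "\<lambda>u. (?k1 u)\<^sup>2 * ?w u"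
  define i1 where "i1 \<rho> = arc_integral \<gamma> (\<gamma> -` cball 0 \<rho>) (\<lambda>u. (?k u)\<^sup>2)" for \<rho>
  define i2 where "i2 \<rho> = arc_integral \<gamma> (\<gamma> -` cball 0 \<rho>) (\<lambda>u. \<bar>\<nu> u \<bullet> \<gamma> u\<bar>)" for \<rho>
  define h where "h \<rho> = 1 / \<rho>\<^sup>2 * i1 \<rho> + \<bar>S\<bar> / \<rho> * i2 (2 * \<rho>)" for \<rho>
  have h: "(h \<longlongrightarrow> 0) at_top"
    using assms(6) by (simp add: h_def[abs_def] i1_def i2_def)
  have nonneg: "i1 \<rho> \<ge> 0" "i2 \<rho> \<ge> 0" for \<rho>
    by (auto simp: i1_def i2_def intro: arc_integral_nonneg)
  have tk: "times_differentiable n ?k" for n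
    by (intro times_differentiable_curvature reg \<gamma> assms(4))
  have cont: "continuous_on A f" if "times_differentiable (Suc 0) f" for A and f :: "real \<Rightarrow> 'c::real_normed_vector"
    using times_differentiable_SucD(1)[OF that]
    by (meson continuous_at_imp_continuous_on has_vector_derivative_continuous)
  have cont_\<gamma>: "continuous_on A \<gamma>" for A
    by (rule cont[OF \<gamma>])
  have cont_k1: "continuous_on A ?k1" and cont_w: "continuous_on A ?w" for A
    by (intro cont times_differentiable_deriv_s tk times_differentiable_speed reg \<gamma>)+
  have cont_e: "continuous_on A ?e" for A
    by (intro continuous_intros cont_k1 cont_w)
  have w: "?w u > 0" for u
    by (rule speed_pos[OF reg])
  have k1: "?k1 u = 0" for u
  proof -
    let ?I = "{u - 1..u + 1}"
    have "bounded (\<gamma> ` ?I)"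
      by (intro compact_imp_bounded compact_continuous_image cont_\<gamma>) auto
    then obtain B where B: "\<And>v. v \<in> ?I \<Longrightarrow> norm (\<gamma> v) \<le> B"
      unfolding bounded_iff by blast
    \<comment> \<open>The energy estimate has both integrals over the ball of radius
      \<open>R\<close>, whereas \<open>h\<close> doubles the radius in the second one. Hence
      \<open>h\<close> is evaluated at \<open>R\<close> for the curvature and at
      \<open>R / 2\<close> for the normal component.\<close>
    have bound: "integral ?I ?e \<le> 64 * h R + 32 * h (R / 2)" if R: "R > 0" "R \<ge> 2 * B" for R
    proof -
      \<comment> \<open>The 8 is the inverse of \<open>(1 / 2)\<^sup>2 / 2\<close>: the squared
        lower bound of the cutoff times the half in the energy estimate.\<close>
      have "integral ?I (\<lambda>v. ?e v / 8) \<le>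
          integral ?I (\<lambda>v. (cutoff R (\<gamma> v))\<^sup>2 * (?k1 v)\<^sup>2 / 2 * ?w v)"
      proof (intro integral_le integrable_continuous_interval)
        show "continuous_on ?I (\<lambda>v. (cutoff R (\<gamma> v))\<^sup>2 * (?k1 v)\<^sup>2 / 2 * ?w v)"
          unfolding cutoff_def using R by (intro continuous_intros cont_\<gamma> cont_k1 cont_w) auto
        fix v assume "v \<in> ?I"
        then have "cutoff R (\<gamma> v) \<ge> 1 / 2"
          using B[of v] R by (intro cutoff_ge_half) auto
        then have "(cutoff R (\<gamma> v))\<^sup>2 \<ge> (1 / 2)\<^sup>2"
          by (intro power_mono) auto
        from mult_right_mono[OF this, of "?e v / 2"] w[of v]
        show "?e v / 8 \<le> (cutoff R (\<gamma> v))\<^sup>2 * (?k1 v)\<^sup>2 / 2 * ?w v"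
          by (simp add: power2_eq_square[of 2] power_divide mult_ac)
      qed (intro continuous_intros cont_e, auto)
      also have "\<dots> \<le> 8 / R\<^sup>2 * i1 R + 8 * \<bar>S\<bar> / R * i2 R"
        unfolding i1_def i2_def by (rule rotator_energy_estimate[OF reg \<gamma> assms(3,4,5) R(1)])
      also have "8 / R\<^sup>2 * i1 R \<le> 8 * h R"
        using nonneg R(1) by (simp add: h_def)
      also have "8 * \<bar>S\<bar> / R * i2 R \<le> 4 * h (R / 2)"
        using nonneg(1)[of "R / 2"] R(1) by (simp add: h_def algebra_simps)
      finally show ?thesis
        by simp
    qed
    have "filterlim (\<lambda>R :: real. R / 2) at_top at_top"
      using filterlim_tendsto_pos_mult_at_top[OF tendsto_const[of "1/2 :: real"] _ filterlim_ident]
      by simp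
    from filterlim_compose[OF h this]
    have "((\<lambda>R. 64 * h R + 32 * h (R / 2)) \<longlongrightarrow> 64 * 0 + 32 * 0) at_top"
      by (intro tendsto_intros h)
    \<comment> \<open>The left side does not depend on \<open>R\<close>, so it lies below the limit
      0 of the right side.\<close>
    moreover have "eventually (\<lambda>R. integral ?I ?e \<le> 64 * h R + 32 * h (R / 2)) at_top"
      using eventually_gt_at_top[of 0] eventually_ge_at_top[of "2 * B"]
      by eventually_elim (rule bound)
    ultimately have "integral ?I ?e \<le> 0"
      using tendsto_lowerbound[OF _ _ trivial_limit_at_top_linorder] by fastforce
    moreover have "integral ?I ?e \<ge> 0"
      using w by (intro integral_nonneg integrable_continuous_interval cont_e) (auto simp: less_imp_le)
    ultimately have "integral ?I ?e = 0"
      by simp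
    \<comment> \<open>A continuous nonnegative function with zero integral vanishes on the interval,
      in particular at its midpoint \<open>u\<close>.\<close>
    then have "?e u = 0"
      using integral_eq_0_iff[OF cont_e, of "u - 1" "u + 1"] w by (auto simp: less_imp_le)
    then show "?k1 u = 0"
      using w[of u] by simp
  qed
  have "(?k has_vector_derivative 0) (at u within UNIV)" for u
    using has_vector_derivative_deriv_s[OF reg tk, of u] k1 by simp
  then obtain c where c: "?k u = c" for u
    using has_vector_derivative_zero_constant[of UNIV ?k] by auto
  have "c = 0"
    by (rule constant_curvature_proper_imp_zero[OF reg \<gamma> assms(3,4) c])
  then show ?thesis
    using c by (intro zero_curvature_imp_straight_line[OF reg \<gamma> assms(3,4)]) simp
qed

end
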